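(* Let $T:(0,\infty)\to\mathbb{R}$ be measurable. (I) Assume that $\lim_{t\to0^+}T(t)$ exists and is finite. If there are constants $\eta>0$ and $C>0$ such that $|T(t)|\le C t^{-\eta}$ for all $t\ge 1$, then $$\lim_{t\to0^+}T(t)=\lim_{\gamma\to0^+}\gamma\int_0^\infty T(t)\,t^{\gamma-1}\,dt .$$ (II) Assume that $\lim_{t\to+\infty}T(t)$ exists and is finite. If there are constants $\eta>0$ and $C>0$ such that $|T(t)|\le C t^{\eta}$ for all $0<t\le 1$, then $$\lim_{t\to+\infty}T(t)=\lim_{\gamma\to0^-}(-\gamma)\int_0^\infty T(t)\,t^{\gamma-1}\,dt .$$
   Formalization: T is also assumed Lebesgue integrable on every [a,b] with 0<a<b; without this the integrals can diverge for every γ, e.g. T(t)=1/|t-1/2| on (0,1), T=0 for t≥1 in (I), so the claim fails as stated. *)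

theory Defs
  imports "HOL-Analysis.Analysis"
begin

text \<open>
  A function on the open half-line is represented by a total function on the reals whose values
  outside \<open>{0<..}\<close> are never used. Measurability and integrals are with respect to
  Lebesgue measure.

  Measurability, the one-sided limit and the growth bound do not make
  \<open>T t * t powr (\<gamma> - 1)\<close> integrable on \<open>{0<..}\<close>: for
  \<open>T t = 1 / \<bar>t - 1/2\<bar>\<close> on \<open>{0<..<1}\<close> and \<open>T t = 0\<close>
  elsewhere, the limit at 0 is 2, the bound on \<open>{1..}\<close> is trivial, and the integral
  diverges for every \<open>\<gamma>\<close>. For the integrals to be meaningful, \<open>T\<close> must also be
  integrable on compact subintervals of \<open>{0<..}\<close>. Given the other hypotheses this is
  equivalent to integrability of \<open>T t * t powr (\<gamma> - 1)\<close> for all small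
  \<open>\<gamma>\<close> of the relevant sign.
\<close>

end

theory Submission
  imports Defs
begin

text \<open>
  Near the point where \<open>T\<close> has its limit the measures \<open>\<bar>\<gamma>\<bar> t\<^sup>\<gamma>\<^sup>-\<^sup>1 dt\<close> have total mass tending to 1 as \<open>\<gamma>\<close>
  tends to 0, while away from that point \<open>\<bar>T t\<bar> t\<^sup>\<gamma>\<^sup>-\<^sup>1\<close> has an integrable majorant independent of
  \<open>\<gamma>\<close>, so that the factor \<open>\<gamma>\<close> kills its contribution.
\<close>

text \<open>Stated for a general kernel so that both limits become instances: \<open>c\<close> is
  \<gamma> with \<open>A\<close> an interval at 0, or -\<gamma> with \<open>A\<close> a ray to
  infinity. On \<open>A\<close> the error is at most \<open>e\<close> times a mass tending to 1; off
  \<open>A\<close> it is at most \<open>c\<close> times a fixed integral. Hence \<open>A\<close> and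
  \<open>g\<close> may depend on \<open>e\<close>, but \<open>g\<close> not on \<gamma>.
  Integrability is part of the conclusion because the integral of a non-integrable function is 0 by
  convention, so the limit alone would not show that the integrals exist.\<close>

lemma tendsto_approximate_identity:
  fixes T :: "'a \<Rightarrow> real" and K :: "'b \<Rightarrow> 'a \<Rightarrow> real" and c :: "'b \<Rightarrow> real"
  assumes S: "S \<in> sets M" and T: "set_borel_measurable M S T"
    and K: "\<And>\<gamma>. K \<gamma> \<in> borel_measurable M" "\<And>\<gamma> t. 0 \<le> K \<gamma> t"
    and c: "(c \<longlongrightarrow> 0) F" "\<forall>\<^sub>F \<gamma> in F. 0 \<le> c \<gamma>"
    and ex: "\<And>e. 0 < e \<Longrightarrow> \<exists>A g. A \<in> sets M \<and> A \<subseteq> S \<and> (\<forall>t\<in>A. \<bar>T t - L\<bar> \<le> e) \<and>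
        (\<forall>\<^sub>F \<gamma> in F. set_integrable M A (K \<gamma>)) \<and>
        ((\<lambda>\<gamma>. c \<gamma> * (LINT t:A|M. K \<gamma> t)) \<longlongrightarrow> 1) F \<and>
        set_integrable M (S - A) g \<and>
        (\<forall>\<^sub>F \<gamma> in F. \<forall>t\<in>S - A. \<bar>T t * K \<gamma> t\<bar> \<le> g t)"
  shows "(\<forall>\<^sub>F \<gamma> in F. set_integrable M S (\<lambda>t. T t * K \<gamma> t)) \<and>
         ((\<lambda>\<gamma>. c \<gamma> * (LINT t:S|M. T t * K \<gamma> t)) \<longlongrightarrow> L) F"
proof -
  have main: "\<forall>\<^sub>F \<gamma> in F. set_integrable M S (\<lambda>t. T t * K \<gamma> t) \<and>
      \<bar>c \<gamma> * (LINT t:S|M. T t * K \<gamma> t) - L\<bar> < e" if e: "0 < e" for e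
  proof -
    obtain A g where A: "A \<in> sets M" "A \<subseteq> S" "\<And>t. t \<in> A \<Longrightarrow> \<bar>T t - L\<bar> \<le> e/2"
      and KA: "\<forall>\<^sub>F \<gamma> in F. set_integrable M A (K \<gamma>)"
      and lim: "((\<lambda>\<gamma>. c \<gamma> * (LINT t:A|M. K \<gamma> t)) \<longlongrightarrow> 1) F"
      and g: "set_integrable M (S - A) g"
      and dom: "\<forall>\<^sub>F \<gamma> in F. \<forall>t\<in>S - A. \<bar>T t * K \<gamma> t\<bar> \<le> g t"
      using ex[of "e/2"] e by auto
    \<comment> \<open>The three terms bound, in order, the defect of the mass on \<open>A\<close>
      from 1, the oscillation of \<open>T\<close> on \<open>A\<close>, and the contribution of
      \<open>S - A\<close>. The limit of \<open>R\<close> is \<open>e/2\<close>; using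
      \<open>e/2\<close> rather than \<open>e\<close> on \<open>A\<close> leaves room for the strict
      inequality.\<close>
    define R where "R \<gamma> = \<bar>L\<bar> * \<bar>c \<gamma> * (LINT t:A|M. K \<gamma> t) - 1\<bar>
      + e/2 * (c \<gamma> * (LINT t:A|M. K \<gamma> t)) + c \<gamma> * (LINT t:S-A|M. g t)" for \<gamma>
    have "(R \<longlongrightarrow> \<bar>L\<bar> * \<bar>1 - 1\<bar> + e/2 * 1 + 0 * (LINT t:S-A|M. g t)) F"
      unfolding R_def by (intro tendsto_intros lim c)
    then have Rlt: "\<forall>\<^sub>F \<gamma> in F. R \<gamma> < e"
      using e by (auto intro: order_tendstoD(2))
    \<comment> \<open>\<open>T\<close> is measurable only on \<open>S\<close>, so the product is
      rewritten with \<open>T\<close> cut off to \<open>S\<close>, which changes nothing on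
      \<open>B\<close> as \<open>B\<close> lies in \<open>S\<close>.\<close>
    have meas: "set_borel_measurable M B (\<lambda>t. T t * K \<gamma> t)" if "B \<in> sets M" "B \<subseteq> S" for B \<gamma>
    proof -
      have "(\<lambda>t. (indicator S t *\<^sub>R T t) * (indicator B t * K \<gamma> t)) \<in> borel_measurable M"
        using T K(1) that(1) unfolding set_borel_measurable_def by measurable
      moreover have "(\<lambda>t. (indicator S t *\<^sub>R T t) * (indicator B t * K \<gamma> t))
          = (\<lambda>t. indicator B t *\<^sub>R (T t * K \<gamma> t))"
        using that(2) by (auto simp: indicator_def fun_eq_iff)
      ultimately show ?thesis by (simp add: set_borel_measurable_def)
    qed
    have SA: "S - A \<in> sets M" using S A(1) by auto
    show ?thesis
      using KA dom c(2) Rlt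
    proof eventually_elim
      case (elim \<gamma>)
      \<comment> \<open>On \<open>A\<close> the function \<open>T\<close> is bounded by
        \<open>\<bar>L\<bar> + e/2\<close>, so a multiple of the kernel dominates.\<close>
      have hA: "set_integrable M A (\<lambda>t. T t * K \<gamma> t)"
      proof (rule set_integrable_bound)
        show "set_integrable M A (\<lambda>t. (\<bar>L\<bar> + e/2) * K \<gamma> t)"
          using elim(1) by simp
        show "AE t in M. t \<in> A \<longrightarrow> norm (T t * K \<gamma> t) \<le> norm ((\<bar>L\<bar> + e/2) * K \<gamma> t)"
        proof (intro AE_I2 impI)
          fix t assume "t \<in> A"
          then have "\<bar>T t\<bar> \<le> \<bar>L\<bar> + e/2" using A(3)[of t] by linarith
          then show "norm (T t * K \<gamma> t) \<le> norm ((\<bar>L\<bar> + e/2) * K \<gamma> t)"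
            using e K(2) by (simp add: abs_mult mult_right_mono)
        qed
      qed (rule meas[OF A(1,2)])
      have hB: "set_integrable M (S - A) (\<lambda>t. T t * K \<gamma> t)"
        using elim(2) by (intro set_integrable_bound[OF g] meas SA AE_I2) (auto intro: order_trans)
      have split: "A \<union> (S - A) = S" using A(2) by auto
      have hS: "set_integrable M S (\<lambda>t. T t * K \<gamma> t)"
        using set_integrable_Un[OF hA hB A(1) SA] split by simp
      have eqS: "(LINT t:S|M. T t * K \<gamma> t)
          = (LINT t:A|M. T t * K \<gamma> t) + (LINT t:S-A|M. T t * K \<gamma> t)"
        using set_integral_Un[OF _ hA hB] split by auto
      have "\<bar>LINT t:S-A|M. T t * K \<gamma> t\<bar> \<le> (LINT t:S-A|M. \<bar>T t * K \<gamma> t\<bar>)"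
        using set_integral_norm_bound[OF hB] by simp
      also have "\<dots> \<le> (LINT t:S-A|M. g t)"
        using elim(2) by (intro set_integral_mono set_integrable_abs hB g) auto
      finally have bB: "\<bar>LINT t:S-A|M. T t * K \<gamma> t\<bar> \<le> (LINT t:S-A|M. g t)" .
      have LK: "set_integrable M A (\<lambda>t. L * K \<gamma> t)" and eK: "set_integrable M A (\<lambda>t. e/2 * K \<gamma> t)"
        using elim(1) by simp_all
      have dK: "set_integrable M A (\<lambda>t. T t * K \<gamma> t - L * K \<gamma> t)"
        by (intro set_integral_diff hA LK)
      have "\<bar>LINT t:A|M. T t * K \<gamma> t - L * K \<gamma> t\<bar> \<le> (LINT t:A|M. \<bar>T t * K \<gamma> t - L * K \<gamma> t\<bar>)"
        using set_integral_norm_bound[OF dK] by simp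
      also have "\<dots> \<le> (LINT t:A|M. e/2 * K \<gamma> t)"
      proof (intro set_integral_mono set_integrable_abs dK eK)
        fix t assume "t \<in> A"
        have "\<bar>T t * K \<gamma> t - L * K \<gamma> t\<bar> = \<bar>T t - L\<bar> * K \<gamma> t"
          using K(2) by (simp add: abs_mult flip: left_diff_distrib)
        also have "\<dots> \<le> e/2 * K \<gamma> t"
          using A(3)[OF \<open>t \<in> A\<close>] K(2) by (rule mult_right_mono)
        finally show "\<bar>T t * K \<gamma> t - L * K \<gamma> t\<bar> \<le> e/2 * K \<gamma> t" .
      qed
      finally have bA: "\<bar>(LINT t:A|M. T t * K \<gamma> t) - L * (LINT t:A|M. K \<gamma> t)\<bar>
          \<le> e/2 * (LINT t:A|M. K \<gamma> t)"
        by (simp add: set_integral_diff(2)[OF hA LK])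
      \<comment> \<open>An exact identity obtained by inserting L times the mass of
        \<open>A\<close>; its three summands are bounded one by one by those of \<open>R\<close>,
        the last two using \<open>c \<gamma> \<ge> 0\<close>.\<close>
      have "c \<gamma> * (LINT t:S|M. T t * K \<gamma> t) - L
          = L * (c \<gamma> * (LINT t:A|M. K \<gamma> t) - 1)
            + c \<gamma> * ((LINT t:A|M. T t * K \<gamma> t) - L * (LINT t:A|M. K \<gamma> t))
            + c \<gamma> * (LINT t:S-A|M. T t * K \<gamma> t)"
        by (simp add: eqS algebra_simps)
      moreover have "\<bar>c \<gamma> * ((LINT t:A|M. T t * K \<gamma> t) - L * (LINT t:A|M. K \<gamma> t))\<bar>
          \<le> c \<gamma> * (e/2 * (LINT t:A|M. K \<gamma> t))"
        using mult_left_mono[OF bA elim(3)] elim(3) by (simp add: abs_mult)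
      moreover have "\<bar>c \<gamma> * (LINT t:S-A|M. T t * K \<gamma> t)\<bar> \<le> c \<gamma> * (LINT t:S-A|M. g t)"
        using mult_left_mono[OF bB elim(3)] elim(3) by (simp add: abs_mult)
      moreover have "\<bar>L * (c \<gamma> * (LINT t:A|M. K \<gamma> t) - 1)\<bar>
          = \<bar>L\<bar> * \<bar>c \<gamma> * (LINT t:A|M. K \<gamma> t) - 1\<bar>"
        by (rule abs_mult)
      ultimately have "\<bar>c \<gamma> * (LINT t:S|M. T t * K \<gamma> t) - L\<bar> \<le> R \<gamma>"
        unfolding R_def by (simp add: mult.left_commute)
      with elim(4) hS show ?case by simp
    qed
  qed
  have "\<forall>\<^sub>F \<gamma> in F. dist (c \<gamma> * (LINT t:S|M. T t * K \<gamma> t)) L < e" if "0 < e" for e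
    using main[OF that] by eventually_elim (simp add: dist_real_def)
  moreover have "\<forall>\<^sub>F \<gamma> in F. set_integrable M S (\<lambda>t. T t * K \<gamma> t)"
    using main[of 1] by (auto elim: eventually_mono)
  ultimately show ?thesis by (simp add: tendsto_iff)
qed

section \<open>Integrals of powers near 0 and near infinity\<close>

lemma
  fixes f :: "real \<Rightarrow> real"
  assumes "(f has_integral I) A" "\<And>x. x \<in> A \<Longrightarrow> 0 \<le> f x"
  shows set_integrable_nonneg_has_integral: "set_integrable lebesgue A f"
    and set_integral_nonneg_has_integral: "(LINT x:A|lebesgue. f x) = I"
proof -
  \<comment> \<open>A nonnegative gauge-integrable function is absolutely integrable, so closed
    forms for the gauge integral pass to the Lebesgue integral.\<close>
  show "set_integrable lebesgue A f"
    using assms by (intro nonnegative_absolutely_integrable_1) (auto simp: integrable_on_def)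
  then show "(LINT x:A|lebesgue. f x) = I"
    using assms(1) by (simp add: set_lebesgue_integral_eq_integral integral_unique)
qed

lemma
  fixes d \<alpha> :: real
  assumes "0 < \<alpha>" "0 \<le> d"
  shows set_integrable_powr_from_0: "set_integrable lebesgue {0<..d} (\<lambda>t. t powr (\<alpha> - 1))"
    and set_integral_powr_from_0: "(LINT t:{0<..d}|lebesgue. t powr (\<alpha> - 1)) = d powr \<alpha> / \<alpha>"
proof -
  have "((\<lambda>t. t powr (\<alpha> - 1)) has_integral d powr \<alpha> / \<alpha>) {0..d}"
    using has_integral_powr_from_0[of "\<alpha> - 1" d] assms by simp
  \<comment> \<open>The point 0 is removed because the theorem integrates over the open half-line; a
    single point is negligible.\<close>
  then have hi: "((\<lambda>t. t powr (\<alpha> - 1)) has_integral d powr \<alpha> / \<alpha>) {0<..d}"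
    by (rule has_integral_spike_set_eq[THEN iffD1, rotated -1]) (auto intro: negligible_subset[of "{0}"])
  show "set_integrable lebesgue {0<..d} (\<lambda>t. t powr (\<alpha> - 1))"
    using hi by (rule set_integrable_nonneg_has_integral) simp
  show "(LINT t:{0<..d}|lebesgue. t powr (\<alpha> - 1)) = d powr \<alpha> / \<alpha>"
    using hi by (rule set_integral_nonneg_has_integral) simp
qed

lemma
  fixes a \<alpha> :: real
  assumes "\<alpha> < 0" "0 < a"
  shows set_integrable_powr_to_inf: "set_integrable lebesgue {a..} (\<lambda>t. t powr (\<alpha> - 1))"
    and set_integral_powr_to_inf: "(LINT t:{a..}|lebesgue. t powr (\<alpha> - 1)) = a powr \<alpha> / (- \<alpha>)"
proof -
  have hi: "((\<lambda>t. t powr (\<alpha> - 1)) has_integral a powr \<alpha> / (- \<alpha>)) {a..}"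
    using has_integral_powr_to_inf[of "\<alpha> - 1" a] assms by simp
  show "set_integrable lebesgue {a..} (\<lambda>t. t powr (\<alpha> - 1))"
    using hi by (rule set_integrable_nonneg_has_integral) simp
  show "(LINT t:{a..}|lebesgue. t powr (\<alpha> - 1)) = a powr \<alpha> / (- \<alpha>)"
    using hi by (rule set_integral_nonneg_has_integral) simp
qed

text \<open>By the closed forms above, \<open>d powr \<gamma>\<close> is the normalised mass on
  \<open>{0<..d}\<close> for positive \<gamma> and on \<open>{d..}\<close> for negative \<gamma>. It
  tends to 1 for every cut-off \<open>d\<close>.\<close>

lemma tendsto_powr_exponent_0:
  fixes d :: real
  assumes "0 < d"
  shows "((\<lambda>\<gamma>. d powr \<gamma>) \<longlongrightarrow> 1) (at 0 within S)"
proof -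
  have "((\<lambda>\<gamma>. d powr \<gamma>) \<longlongrightarrow> d powr 0) (at 0 within S)"
    using assms by (intro tendsto_intros) auto
  then show ?thesis using assms by simp
qed

theorem theorem1p1:
  fixes T :: "real \<Rightarrow> real"
  assumes "T \<in> borel_measurable (lebesgue_on {0<..})"
    and "\<And>a b. 0 < a \<Longrightarrow> a < b \<Longrightarrow> set_integrable lebesgue {a..b} T"
  shows
    "(\<forall>L \<eta> C. (T \<longlongrightarrow> L) (at_right 0) \<and> \<eta> > 0 \<and> C > 0 \<and>
        (\<forall>t\<ge>1. \<bar>T t\<bar> \<le> C * t powr (-\<eta>)) \<longrightarrow>
        (\<forall>\<^sub>F \<gamma> in at_right 0. set_integrable lebesgue {0<..} (\<lambda>t. T t * t powr (\<gamma> - 1))) \<and>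
        ((\<lambda>\<gamma>. \<gamma> * (LINT t:{0<..}|lebesgue. T t * t powr (\<gamma> - 1))) \<longlongrightarrow> L) (at_right 0))
     \<and>
     (\<forall>L \<eta> C. (T \<longlongrightarrow> L) at_top \<and> \<eta> > 0 \<and> C > 0 \<and>
        (\<forall>t. 0 < t \<and> t \<le> 1 \<longrightarrow> \<bar>T t\<bar> \<le> C * t powr \<eta>) \<longrightarrow>
        (\<forall>\<^sub>F \<gamma> in at_left 0. set_integrable lebesgue {0<..} (\<lambda>t. T t * t powr (\<gamma> - 1))) \<and>
        ((\<lambda>\<gamma>. (-\<gamma>) * (LINT t:{0<..}|lebesgue. T t * t powr (\<gamma> - 1))) \<longlongrightarrow> L) (at_left 0))"
proof -
  have S: "{0<..} \<in> sets (lebesgue :: real measure)" by simp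
  have T: "set_borel_measurable lebesgue {0<..} T"
    using assms(1) by (simp add: set_borel_measurable_def borel_measurable_restrict_space_iff)
  have K: "(\<lambda>t. t powr (\<gamma> - 1)) \<in> borel_measurable lebesgue" for \<gamma> :: real
    by (intro measurable_completion) measurable
  \<comment> \<open>With the kernel fixed, the two halves differ only in the filter, the factor
    \<open>c\<close>, the set \<open>A\<close> and the majorant \<open>g\<close>.\<close>
  note approx = tendsto_approximate_identity[OF S T K powr_ge_zero]
  have near0: "(\<forall>\<^sub>F \<gamma> in at_right 0. set_integrable lebesgue {0<..} (\<lambda>t. T t * t powr (\<gamma> - 1))) \<and>
      ((\<lambda>\<gamma>. \<gamma> * (LINT t:{0<..}|lebesgue. T t * t powr (\<gamma> - 1))) \<longlongrightarrow> L) (at_right 0)"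
    if L: "(T \<longlongrightarrow> L) (at_right 0)" and pos: "\<eta> > 0" "C > 0"
      and bound: "\<And>t. t \<ge> 1 \<Longrightarrow> \<bar>T t\<bar> \<le> C * t powr (-\<eta>)" for L \<eta> C
  proof (rule approx)
    show "((\<lambda>\<gamma>::real. \<gamma>) \<longlongrightarrow> 0) (at_right 0)" by (rule tendsto_ident_at)
    show "\<forall>\<^sub>F \<gamma> in at_right 0. 0 \<le> (\<gamma>::real)"
      by (auto simp: eventually_at_filter)
  next
    fix e :: real assume "0 < e"
    then have "\<forall>\<^sub>F t in at_right 0. dist (T t) L < e"
      using L by (auto simp: tendsto_iff)
    then obtain b where b: "b > 0" "\<And>t. 0 < t \<Longrightarrow> t < b \<Longrightarrow> dist (T t) L < e"
      by (auto simp: eventually_at_right_field)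
    \<comment> \<open>Staying strictly below \<open>b\<close> puts the closed endpoint
      \<open>d\<close> inside the region where \<open>T\<close> is close to L; staying below 1 makes
      \<open>{d..1}\<close> an interval on which \<open>T\<close> is assumed integrable.\<close>
    define d where "d = min (b/2) (1/2)"
    have d: "0 < d" "d < b" "d < 1" using b(1) by (auto simp: d_def)
    \<comment> \<open>For \<open>d < t \<le> 1\<close> and positive \<gamma>,
      \<open>t powr (\<gamma> - 1)\<close> is at most \<open>1/t\<close>, hence at most
      \<open>1/d\<close>. For \<open>t > 1\<close> the decay exponent \<eta> is split: with
      \<open>\<gamma> < \<eta>/2\<close>, one half absorbs \<gamma> and the other keeps the majorant
      integrable at infinity.\<close>
    define g where "g t = (if t \<le> 1 then \<bar>T t\<bar> / d else C * t powr (-\<eta>/2 - 1))" for t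
    have g1: "set_integrable lebesgue {d<..1} g"
    proof -
      have "set_integrable lebesgue {d<..1} T"
        using assms(2)[OF d(1) d(3)] by (rule set_integrable_subset) auto
      then have "set_integrable lebesgue {d<..1} (\<lambda>t. \<bar>T t\<bar> / d)"
        by (intro set_integrable_divide set_integrable_abs)
      then show ?thesis
        by (rule set_integrable_cong[THEN iffD1, rotated -1]) (auto simp: g_def)
    qed
    have g2: "set_integrable lebesgue {1<..} g"
    proof -
      have "set_integrable lebesgue {1..} (\<lambda>t. t powr (-\<eta>/2 - 1))"
        using pos by (intro set_integrable_powr_to_inf) auto
      then have "set_integrable lebesgue {1<..} (\<lambda>t. t powr (-\<eta>/2 - 1))"
        by (rule set_integrable_subset) auto
      then have "set_integrable lebesgue {1<..} (\<lambda>t. C * t powr (-\<eta>/2 - 1))"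
        by simp
      then show ?thesis
        by (rule set_integrable_cong[THEN iffD1, rotated -1]) (auto simp: g_def)
    qed
    have "{0<..} - {0<..d} = {d<..1} \<union> {1<..}" using d by auto
    then have g: "set_integrable lebesgue ({0<..} - {0<..d}) g"
      using set_integrable_Un[OF g1 g2] by simp
    have ev: "\<forall>\<^sub>F \<gamma>::real in at_right 0. 0 < \<gamma> \<and> \<gamma> < min 1 (\<eta>/2)"
      unfolding eventually_at_right_field using pos by (intro exI[of _ "min 1 (\<eta>/2)"]) auto
    have dom: "\<bar>T t * t powr (\<gamma> - 1)\<bar> \<le> g t"
      if "0 < \<gamma>" "\<gamma> < min 1 (\<eta>/2)" "t \<in> {0<..} - {0<..d}" for t \<gamma>
    proof (cases "t \<le> 1")
      case True
      have t: "d < t" "0 < t" using that d by auto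
      have "t powr (\<gamma> - 1) \<le> t powr (-1)"
        using that t True by (intro powr_mono') auto
      also have "\<dots> \<le> 1 / d"
        using t d by (simp add: powr_minus field_simps)
      finally have "\<bar>T t\<bar> * t powr (\<gamma> - 1) \<le> \<bar>T t\<bar> * (1 / d)"
        by (intro mult_left_mono) auto
      then show ?thesis using True by (simp add: g_def abs_mult)
    next
      case False
      have "\<bar>T t\<bar> * t powr (\<gamma> - 1) \<le> (C * t powr (-\<eta>)) * t powr (\<gamma> - 1)"
        using bound False by (intro mult_right_mono) auto
      also have "\<dots> = C * t powr (\<gamma> - \<eta> - 1)"
        by (simp add: algebra_simps flip: powr_add)
      also have "\<dots> \<le> C * t powr (-\<eta>/2 - 1)"
        using pos that False by (intro mult_left_mono powr_mono) auto
      finally show ?thesis using False by (simp add: g_def abs_mult)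
    qed
    show "\<exists>A g. A \<in> sets lebesgue \<and> A \<subseteq> {0<..} \<and> (\<forall>t\<in>A. \<bar>T t - L\<bar> \<le> e) \<and>
        (\<forall>\<^sub>F \<gamma> in at_right 0. set_integrable lebesgue A (\<lambda>t. t powr (\<gamma> - 1))) \<and>
        ((\<lambda>\<gamma>. \<gamma> * (LINT t:A|lebesgue. t powr (\<gamma> - 1))) \<longlongrightarrow> 1) (at_right 0) \<and>
        set_integrable lebesgue ({0<..} - A) g \<and>
        (\<forall>\<^sub>F \<gamma> in at_right 0. \<forall>t\<in>{0<..} - A. \<bar>T t * t powr (\<gamma> - 1)\<bar> \<le> g t)"
    \<comment> \<open>The witnesses are left schematic: the first \<open>show\<close> fixes
      \<open>A\<close> as \<open>{0<..d}\<close>, the last one fixes the majorant.\<close>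
    proof (intro exI conjI)
      show "\<forall>t\<in>{0<..d}. \<bar>T t - L\<bar> \<le> e"
        using b(2) d by (force simp: dist_real_def)
      show "\<forall>\<^sub>F \<gamma> in at_right 0. set_integrable lebesgue {0<..d} (\<lambda>t. t powr (\<gamma> - 1))"
        using ev by eventually_elim (use d in \<open>auto intro: set_integrable_powr_from_0\<close>)
      \<comment> \<open>The factor \<gamma> cancels the denominator of the closed form, which is
        available only for positive \<gamma>; equality near 0 is enough for the limit.\<close>
      have "\<forall>\<^sub>F \<gamma> in at_right 0. d powr \<gamma> = \<gamma> * (LINT t:{0<..d}|lebesgue. t powr (\<gamma> - 1))"
        using ev by eventually_elim (use d in \<open>simp add: set_integral_powr_from_0\<close>)
      then show "((\<lambda>\<gamma>. \<gamma> * (LINT t:{0<..d}|lebesgue. t powr (\<gamma> - 1))) \<longlongrightarrow> 1) (at_right 0)"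
        by (rule Lim_transform_eventually[OF tendsto_powr_exponent_0[OF d(1)]])
      show "\<forall>\<^sub>F \<gamma> in at_right 0. \<forall>t\<in>{0<..} - {0<..d}. \<bar>T t * t powr (\<gamma> - 1)\<bar> \<le> g t"
        using ev by eventually_elim (use dom in blast)
    qed (use g in auto)
  qed
  \<comment> \<open>The mirror image under \<open>t\<close> to \<open>1/t\<close>, argued directly:
    the set carrying the mass is now a ray, and the growth bound controls the end at 0.\<close>
  have near_top: "(\<forall>\<^sub>F \<gamma> in at_left 0. set_integrable lebesgue {0<..} (\<lambda>t. T t * t powr (\<gamma> - 1))) \<and>
      ((\<lambda>\<gamma>. (-\<gamma>) * (LINT t:{0<..}|lebesgue. T t * t powr (\<gamma> - 1))) \<longlongrightarrow> L) (at_left 0)"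
    if L: "(T \<longlongrightarrow> L) at_top" and pos: "\<eta> > 0" "C > 0"
      and bound: "\<And>t. 0 < t \<Longrightarrow> t \<le> 1 \<Longrightarrow> \<bar>T t\<bar> \<le> C * t powr \<eta>" for L \<eta> C
  proof (rule approx)
    show "((\<lambda>\<gamma>::real. - \<gamma>) \<longlongrightarrow> 0) (at_left 0)"
      using tendsto_minus[OF tendsto_ident_at[of "0::real" "{..<0}"]] by simp
    show "\<forall>\<^sub>F \<gamma> in at_left 0. 0 \<le> - (\<gamma>::real)"
      by (auto simp: eventually_at_filter)
  next
    fix e :: real assume "0 < e"
    then have "\<forall>\<^sub>F t in at_top. dist (T t) L < e"
      using L by (auto simp: tendsto_iff)
    then obtain b where b: "\<And>t. b \<le> t \<Longrightarrow> dist (T t) L < e"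
      by (auto simp: eventually_at_top_linorder)
    \<comment> \<open>At least \<open>b\<close>, so that \<open>T\<close> is close to L on all of
      \<open>{d..}\<close>, and above 1, so that local integrability applies on
      \<open>{1..d}\<close>.\<close>
    define d where "d = max b 2"
    have d: "b \<le> d" "1 < d" by (auto simp: d_def)
    \<comment> \<open>For \<open>1 < t\<close> the kernel is at most 1, since \<gamma> is negative,
      so \<open>\<bar>T t\<bar>\<close> itself dominates on the bounded piece. For
      \<open>t \<le> 1\<close> a smaller exponent gives a larger power, so
      \<open>\<gamma> > -\<eta>/2\<close> bounds \<open>t powr (\<eta> + \<gamma> - 1)\<close> by
      \<open>t powr (\<eta>/2 - 1)\<close>, which is integrable at 0.\<close>
    define g where "g t = (if 1 < t then \<bar>T t\<bar> else C * t powr (\<eta>/2 - 1))" for t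
    have g1: "set_integrable lebesgue {1<..<d} g"
    proof -
      have "set_integrable lebesgue {1<..<d} T"
        using assms(2)[OF zero_less_one d(2)] by (rule set_integrable_subset) auto
      then have "set_integrable lebesgue {1<..<d} (\<lambda>t. \<bar>T t\<bar>)"
        by (rule set_integrable_abs)
      then show ?thesis
        by (rule set_integrable_cong[THEN iffD1, rotated -1]) (auto simp: g_def)
    qed
    have g2: "set_integrable lebesgue {0<..1} g"
    proof -
      have "set_integrable lebesgue {0<..1} (\<lambda>t. t powr (\<eta>/2 - 1))"
        using pos by (intro set_integrable_powr_from_0) auto
      then have "set_integrable lebesgue {0<..1} (\<lambda>t. C * t powr (\<eta>/2 - 1))"
        by simp
      then show ?thesis
        by (rule set_integrable_cong[THEN iffD1, rotated -1]) (auto simp: g_def)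
    qed
    have "{0<..} - {d..} = {1<..<d} \<union> {0<..1}" using d by auto
    then have g: "set_integrable lebesgue ({0<..} - {d..}) g"
      using set_integrable_Un[OF g1 g2] by simp
    have ev: "\<forall>\<^sub>F \<gamma>::real in at_left 0. - (\<eta>/2) < \<gamma> \<and> \<gamma> < 0"
      unfolding eventually_at_left_field using pos by (intro exI[of _ "- (\<eta>/2)"]) auto
    have dom: "\<bar>T t * t powr (\<gamma> - 1)\<bar> \<le> g t"
      if "- (\<eta>/2) < \<gamma>" "\<gamma> < 0" "t \<in> {0<..} - {d..}" for t \<gamma>
    proof (cases "1 < t")
      case True
      have "t powr (\<gamma> - 1) \<le> t powr 0"
        using that True by (intro powr_mono) auto
      then have "\<bar>T t\<bar> * t powr (\<gamma> - 1) \<le> \<bar>T t\<bar> * 1"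
        using True by (intro mult_left_mono) auto
      then show ?thesis using True by (simp add: g_def abs_mult)
    next
      case False
      have t: "0 < t" "t \<le> 1" using that False by auto
      have "\<bar>T t\<bar> * t powr (\<gamma> - 1) \<le> (C * t powr \<eta>) * t powr (\<gamma> - 1)"
        using bound t by (intro mult_right_mono) auto
      also have "\<dots> = C * t powr (\<eta> + \<gamma> - 1)"
        by (simp add: algebra_simps flip: powr_add)
      also have "\<dots> \<le> C * t powr (\<eta>/2 - 1)"
        using pos that t by (intro mult_left_mono powr_mono') auto
      finally show ?thesis using False by (simp add: g_def abs_mult)
    qed
    show "\<exists>A g. A \<in> sets lebesgue \<and> A \<subseteq> {0<..} \<and> (\<forall>t\<in>A. \<bar>T t - L\<bar> \<le> e) \<and>
        (\<forall>\<^sub>F \<gamma> in at_left 0. set_integrable lebesgue A (\<lambda>t. t powr (\<gamma> - 1))) \<and>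
        ((\<lambda>\<gamma>. (-\<gamma>) * (LINT t:A|lebesgue. t powr (\<gamma> - 1))) \<longlongrightarrow> 1) (at_left 0) \<and>
        set_integrable lebesgue ({0<..} - A) g \<and>
        (\<forall>\<^sub>F \<gamma> in at_left 0. \<forall>t\<in>{0<..} - A. \<bar>T t * t powr (\<gamma> - 1)\<bar> \<le> g t)"
    proof (intro exI conjI)
      show "\<forall>t\<in>{d..}. \<bar>T t - L\<bar> \<le> e"
        using b d(1) by (auto simp: dist_real_def intro!: less_imp_le)
      show "\<forall>\<^sub>F \<gamma> in at_left 0. set_integrable lebesgue {d..} (\<lambda>t. t powr (\<gamma> - 1))"
        using ev by eventually_elim (use d in \<open>auto intro: set_integrable_powr_to_inf\<close>)
      have "\<forall>\<^sub>F \<gamma> in at_left 0. d powr \<gamma> = (-\<gamma>) * (LINT t:{d..}|lebesgue. t powr (\<gamma> - 1))"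
        using ev by eventually_elim (use d in \<open>simp add: set_integral_powr_to_inf\<close>)
      then show "((\<lambda>\<gamma>. (-\<gamma>) * (LINT t:{d..}|lebesgue. t powr (\<gamma> - 1))) \<longlongrightarrow> 1) (at_left 0)"
        using d by (intro Lim_transform_eventually[OF tendsto_powr_exponent_0]) auto
      show "\<forall>\<^sub>F \<gamma> in at_left 0. \<forall>t\<in>{0<..} - {d..}. \<bar>T t * t powr (\<gamma> - 1)\<bar> \<le> g t"
        using ev by eventually_elim (use dom in blast)
    qed (use g d in auto)
  qed
  show ?thesis using near0 near_top by blast
qed

end
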